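(* Assume the offer distribution satisfies $E[e^{\delta X_+}]<\infty$ for some $\delta>0$. Then, for any $\mu_0\ge 0$ (with $\mu_0<M$), the corresponding optimal policy satisfies, for all $t\ge 0$, $$\mu(t)\le\mu_0+\frac1\delta\ln\left(E[e^{\delta(X-\mu_0)_+}]\cdot\lambda t+1\right).$$
   Context: A seller receives independent offers with cumulative distribution function (CDF) $F$ on $\mathbb{R}$ (the offer distribution), arriving as a Poisson process with rate $\lambda>0$; if no offer is accepted before the deadline, the asset is sold at a random price with CDF $F_0$. $X$ and $X_0$ denote random variables with CDFs $F$ and $F_0$; $y_+=\max(y,0)$; $\mu_0=E[X_0]$; $M=\sup\{x : F(x)<1\}\in(-\infty,+\infty]$. Standing assumptions: $E[X_+]<\infty$, $E[|X_0|]<\infty$, $0\le\mu_0<M$. Define $\phi(x)=\int_x^\infty[1-F(u)]\,du$ and $\Psi(x)=\int_{\mu_0}^x\frac{du}{\phi(u)}$ for $x\in[\mu_0,M)$. The optimal policy (the threshold function such that accepting an offer $x$ arriving when the remaining time to the deadline is $t$ if and only if $x\ge\mu(t)$ maximizes the expected sale price) is the function $\mu:[0,\infty)\to[\mu_0,M)$, $\mu(t)=\Psi^{-1}(\lambda t)$; equivalently, the solution of $\mu'(t)=\lambda\phi(\mu(t))$, $\mu(0)=\mu_0$. It depends on $F_0$ only through $\mu_0$. *)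

theory Defs
  imports "HOL-Probability.Probability"
begin

text \<open>
  A distribution on the reals is a Borel probability measure \<open>D\<close> (\<^locale>\<open>real_distribution\<close>);
  its CDF is \<open>cdf D\<close>, and \<open>E[g(X)]\<close>, for \<open>X\<close> with this CDF, is \<open>LINT x|D. g x\<close>.
\<close>

definition upper_end :: "real measure \<Rightarrow> ereal" where
  "upper_end D = Sup (ereal ` {x. cdf D x < 1})"

definition excess :: "real measure \<Rightarrow> real \<Rightarrow> real" where
  "excess D x = (LINT u:{x..}|lborel. 1 - cdf D u)"

definition policy_time :: "real measure \<Rightarrow> real \<Rightarrow> real \<Rightarrow> real" where
  "policy_time D \<mu>\<^sub>0 x = (LINT u:{\<mu>\<^sub>0..x}|lborel. 1 / excess D u)"

text \<open>
  The optimal threshold \<open>\<mu>(t) = \<Psi>\<^sup>-\<^sup>1(\<lambda>t)\<close>, with \<open>\<Psi>\<close> being \<open>policy_time D \<mu>\<^sub>0\<close> restricted to \<open>[\<mu>\<^sub>0, M)\<close>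
  and \<open>M\<close> being \<open>upper_end D\<close>.
  The value is meaningful only for \<open>t \<ge> 0\<close>: when \<open>D\<close> has integrable positive part and
  \<open>\<mu>\<^sub>0 < M\<close>, \<open>\<Psi>\<close> is a bijection of \<open>[\<mu>\<^sub>0, M)\<close> onto \<open>[0, \<infinity>)\<close>.
\<close>

definition optimal_policy :: "real measure \<Rightarrow> real \<Rightarrow> real \<Rightarrow> real \<Rightarrow> real" where
  "optimal_policy D l \<mu>\<^sub>0 t =
     inv_into {x. \<mu>\<^sub>0 \<le> x \<and> ereal x < upper_end D} (policy_time D \<mu>\<^sub>0) (l * t)"

end

theory Submission
  imports Defs
begin

text \<open>
  Write \<open>\<phi>\<close> for \<^const>\<open>excess\<close>, \<open>\<Psi>\<close> for \<^const>\<open>policy_time\<close>, \<open>b\<close> for \<^const>\<open>upper_end\<close> and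
  \<open>C = E[exp (\<delta> (X - \<mu>\<^sub>0)\<^sub>+)]\<close>.
  Markov's inequality for \<open>exp (\<delta> (X - \<mu>\<^sub>0)\<^sub>+)\<close> gives the tail bound
  \<open>P(X > v) \<le> C exp (-\<delta> (v - \<mu>\<^sub>0))\<close> for \<open>v \<ge> \<mu>\<^sub>0\<close>.  Integrating it over \<open>v \<ge> u\<close> yields
  \<open>\<phi>(u) \<le> (C / \<delta>) exp (-\<delta> (u - \<mu>\<^sub>0))\<close>, and integrating the reciprocal over \<open>[\<mu>\<^sub>0, x]\<close> yields
  \<open>\<Psi>(x) \<ge> (exp (\<delta> (x - \<mu>\<^sub>0)) - 1) / C\<close> (lemma \<open>policy_time_ge_exponential\<close>).
  At \<open>x = \<mu>(t)\<close>, where \<open>\<Psi>(x) = \<lambda>t\<close>, solving for \<open>x\<close> gives the theorem.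

  That \<open>\<Psi>(\<mu>(t)) = \<lambda>t\<close> needs \<open>\<lambda>t\<close> to be a value of \<open>\<Psi>\<close> on \<open>[\<mu>\<^sub>0, b)\<close> (lemma
  \<open>policy_time_surjective\<close>).  There \<open>\<phi>\<close> is positive and Lipschitz, so \<open>\<Psi>\<close> is continuous,
  and \<open>\<Psi>(\<mu>\<^sub>0) = 0\<close>; the intermediate value theorem applies because \<open>\<Psi>\<close> is unbounded.
  Indeed, if \<open>b = \<infinity>\<close> then \<open>1 / \<phi>\<close> is at least the positive constant \<open>1 / \<phi>(\<mu>\<^sub>0)\<close>; if \<open>b < \<infinity>\<close> then
  \<open>\<phi>(u) \<le> b - u\<close>, and the integral of \<open>1 / (b - u)\<close> diverges logarithmically at \<open>b\<close>.
\<close>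

section \<open>The integrated tail\<close>

context real_distribution
begin

lemma cdf_measurable [measurable]: "cdf M \<in> borel_measurable borel"
  by (intro borel_measurable_mono monoI cdf_nondecreasing)

lemma less_upper_endD:
  assumes "ereal x < upper_end M"
  obtains y where "x < y" "cdf M y < 1"
proof -
  from assms obtain z where "z \<in> ereal ` {x. cdf M x < 1}" "ereal x < z"
    unfolding upper_end_def less_Sup_iff by blast
  then show ?thesis using that by auto
qed

lemma cdf_eq_1_above_upper_end:
  assumes "upper_end M < ereal y"
  shows "cdf M y = 1"
proof (rule ccontr)
  assume "cdf M y \<noteq> 1"
  then have "cdf M y < 1" using cdf_bounded_prob[of y] by simp
  then have "ereal y \<le> upper_end M" unfolding upper_end_def by (intro Sup_upper) auto
  with assms show False by simp
qed

lemma excess_nonneg: "0 \<le> excess M x"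
  unfolding excess_def set_lebesgue_integral_def
  by (intro Bochner_Integration.integral_nonneg) (simp add: cdf_bounded_prob)

text \<open>
  The decrease of \<open>\<phi>\<close> over \<open>[x, y]\<close> is the integral of the tail over it, and the tail lies
  between its value at \<open>y\<close> and \<open>1\<close>. The lower bound makes \<open>\<phi>\<close> positive below the upper end, the upper
  one makes it Lipschitz.
\<close>

lemma excess_decrease_bounds:
  assumes int: "set_integrable lborel {x..} (\<lambda>u. 1 - cdf M u)" and "x \<le> y"
  shows "(y - x) * (1 - cdf M y) \<le> excess M x - excess M y"
    and "excess M x - excess M y \<le> y - x"
proof -
  have i1: "set_integrable lborel {x..<y} (\<lambda>u. 1 - cdf M u)"
    by (rule set_integrable_subset[OF int]) auto
  have i2: "set_integrable lborel {y..} (\<lambda>u. 1 - cdf M u)"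
    by (rule set_integrable_subset[OF int]) (use \<open>x \<le> y\<close> in auto)
  have c: "set_integrable lborel {x..<y} (\<lambda>u. k)" for k :: real
    by (rule set_integrable_subset[of _ "{x..y}"])
       (auto intro: borel_integrable_atLeastAtMost')
  have "{x..<y} \<union> {y..} = {x..}" using \<open>x \<le> y\<close> by auto
  with set_integral_Un[OF _ i1 i2] have eq:
    "excess M x - excess M y = (LINT u:{x..<y}|lborel. 1 - cdf M u)"
    by (simp add: excess_def ivl_disj_int)
  have cint: "(LINT u:{x..<y}|lborel. k) = k * (y - x)" for k :: real
    using \<open>x \<le> y\<close> by (simp add: set_lebesgue_integral_def)
  have "(LINT u:{x..<y}|lborel. 1 - cdf M y) \<le> (LINT u:{x..<y}|lborel. 1 - cdf M u)"
    by (intro set_integral_mono c i1) (auto intro: cdf_nondecreasing)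
  then show "(y - x) * (1 - cdf M y) \<le> excess M x - excess M y"
    unfolding eq cint by (simp add: mult.commute)
  have "(LINT u:{x..<y}|lborel. 1 - cdf M u) \<le> (LINT u:{x..<y}|lborel. 1)"
    by (intro set_integral_mono c i1) (auto intro: cdf_nonneg)
  then show "excess M x - excess M y \<le> y - x" unfolding eq cint by simp
qed

lemma excess_pos:
  assumes "set_integrable lborel {x..} (\<lambda>u. 1 - cdf M u)" "ereal x < upper_end M"
  shows "0 < excess M x"
proof -
  obtain y where y: "x < y" "cdf M y < 1" using less_upper_endD[OF assms(2)] .
  have "0 < (y - x) * (1 - cdf M y)" using y by simp
  also have "\<dots> \<le> excess M x - excess M y"
    using excess_decrease_bounds(1)[OF assms(1)] y by simp
  finally show ?thesis using excess_nonneg[of y] by simp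
qed

text \<open>
  The Lipschitz bound, taken up to a point \<open>y > b\<close> where \<open>\<phi>\<close> vanishes, in the limit \<open>y \<rightarrow> b\<close>.
\<close>

lemma excess_le_distance_to_upper_end:
  assumes int: "set_integrable lborel {x..} (\<lambda>u. 1 - cdf M u)"
    and b: "upper_end M = ereal b" and "x \<le> b"
  shows "excess M x \<le> b - x"
proof -
  have "excess M x + x \<le> y" if "b < y" for y
  proof -
    have "1 - cdf M u = 0" if "u \<in> {y..}" for u
      using cdf_eq_1_above_upper_end[of u] b that \<open>b < y\<close> by simp
    then have "excess M y = (LINT u:{y..}|lborel. 0)"
      unfolding excess_def by (intro set_lebesgue_integral_cong) auto
    then have "excess M y = 0" by (simp add: set_lebesgue_integral_def)
    with excess_decrease_bounds(2)[OF int, of y] \<open>x \<le> b\<close> that show ?thesis by simp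
  qed
  then have "excess M x + x \<le> b" by (rule dense_ge)
  then show ?thesis by simp
qed

lemma excess_continuous_on:
  assumes int: "set_integrable lborel {a..} (\<lambda>u. 1 - cdf M u)"
  shows "continuous_on {a..} (excess M)"
proof (rule continuous_onI)
  have *: "\<bar>excess M x - excess M y\<bar> \<le> y - x" if "a \<le> x" "x \<le> y" for x y
  proof -
    have i: "set_integrable lborel {x..} (\<lambda>u. 1 - cdf M u)"
      by (rule set_integrable_subset[OF int]) (use that in auto)
    have "0 \<le> (y - x) * (1 - cdf M y)" using that cdf_bounded_prob[of y] by simp
    with excess_decrease_bounds[OF i \<open>x \<le> y\<close>] show ?thesis by simp
  qed
  fix x e :: real assume "x \<in> {a..}" "0 < e"
  have "dist (excess M x') (excess M x) \<le> e" if "x' \<in> {a..}" "dist x' x < e" for x'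
    using *[of x x'] *[of x' x] that \<open>x \<in> {a..}\<close>
    by (cases "x \<le> x'") (auto simp: dist_real_def)
  with \<open>0 < e\<close> show "\<exists>d>0. \<forall>x'\<in>{a..}. dist x' x < d \<longrightarrow>
      dist (excess M x') (excess M x) \<le> e" by blast
qed

section \<open>The policy time\<close>

lemma reciprocal_excess_continuous_on:
  assumes int: "set_integrable lborel {a..} (\<lambda>u. 1 - cdf M u)"
    and x: "ereal x < upper_end M"
  shows "continuous_on {a..x} (\<lambda>u. 1 / excess M u)"
proof (intro continuous_on_divide continuous_on_const ballI)
  show "continuous_on {a..x} (excess M)"
    by (rule continuous_on_subset[OF excess_continuous_on[OF int]]) auto
  fix u assume u: "u \<in> {a..x}"
  have "set_integrable lborel {u..} (\<lambda>u. 1 - cdf M u)"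
    by (rule set_integrable_subset[OF int]) (use u in auto)
  moreover have "ereal u < upper_end M"
    using u x by (auto intro: le_less_trans[of _ "ereal x"])
  ultimately show "excess M u \<noteq> 0" using excess_pos by force
qed

lemma policy_time_continuous_on:
  assumes int: "set_integrable lborel {a..} (\<lambda>u. 1 - cdf M u)"
    and x: "ereal x < upper_end M"
  shows "continuous_on {a..x} (policy_time M a)"
proof -
  have c: "continuous_on {a..x} (\<lambda>u. 1 / excess M u)"
    by (rule reciprocal_excess_continuous_on[OF int x])
  have "policy_time M a y = integral {a..y} (\<lambda>u. 1 / excess M u)" if "y \<in> {a..x}" for y
    unfolding policy_time_def
    by (intro set_borel_integral_eq_integral borel_integrable_atLeastAtMost'
        continuous_on_subset[OF c]) (use that in auto)
  then show ?thesis
    using indefinite_integral_continuous_1[OF integrable_continuous_interval[OF c]]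
    by (subst continuous_on_cong) auto
qed

text \<open>
  Every upper bound \<open>h\<close> on \<open>\<phi>\<close> whose reciprocal has a known antiderivative \<open>G\<close> bounds \<open>\<Psi>\<close> from
  below. This is used with an exponential \<open>h\<close> for the estimate of the policy, and with a
  constant and a linear one for the unboundedness of \<open>\<Psi>\<close>.
\<close>

lemma policy_time_ge_antiderivative:
  assumes int: "set_integrable lborel {a..} (\<lambda>u. 1 - cdf M u)"
    and x: "a \<le> x" "ereal x < upper_end M"
    and le: "\<And>u. a \<le> u \<Longrightarrow> u \<le> x \<Longrightarrow> excess M u \<le> h u"
    and G: "\<And>u. a \<le> u \<Longrightarrow> u \<le> x \<Longrightarrow> (G has_real_derivative 1 / h u) (at u)"
    and cont: "\<And>u. a \<le> u \<Longrightarrow> u \<le> x \<Longrightarrow> isCont (\<lambda>u. 1 / h u) u"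
  shows "G x - G a \<le> policy_time M a x"
proof -
  have "G x - G a = (LINT u:{a..x}|lborel. 1 / h u)"
    using integral_FTC_Icc_real[OF x(1) G cont]
    by (simp add: set_lebesgue_integral_def mult.commute)
  also have "\<dots> \<le> (LINT u:{a..x}|lborel. 1 / excess M u)"
  proof (rule set_integral_mono)
    show "set_integrable lborel {a..x} (\<lambda>u. 1 / h u)"
      using cont by (intro borel_integrable_atLeastAtMost' continuous_at_imp_continuous_on) auto
    show "set_integrable lborel {a..x} (\<lambda>u. 1 / excess M u)"
      by (intro borel_integrable_atLeastAtMost' reciprocal_excess_continuous_on[OF int x(2)])
    fix u assume u: "u \<in> {a..x}"
    have "set_integrable lborel {u..} (\<lambda>u. 1 - cdf M u)"
      by (rule set_integrable_subset[OF int]) (use u in auto)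
    moreover have "ereal u < upper_end M"
      using u x by (auto intro: le_less_trans[of _ "ereal x"])
    ultimately have "0 < excess M u" by (rule excess_pos)
    with le[of u] u show "1 / h u \<le> 1 / excess M u"
      by (intro divide_left_mono) auto
  qed
  finally show ?thesis by (simp add: policy_time_def)
qed

lemma policy_time_unbounded:
  assumes int: "set_integrable lborel {a..} (\<lambda>u. 1 - cdf M u)"
    and a: "ereal a < upper_end M" and s: "0 \<le> s"
  obtains x where "a \<le> x" "ereal x < upper_end M" "s \<le> policy_time M a x"
proof (cases "upper_end M")
  case (real b)
  with a have ab: "a < b" by simp
  \<comment> \<open>chosen so that \<open>ln ((b - a) / (b - x)) = s\<close>\<close>
  define x where "x = b - (b - a) * exp (- s)"
  have xb: "x < b" using ab by (simp add: x_def)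
  have "(b - a) * exp (- s) \<le> (b - a) * 1" using ab s by (intro mult_left_mono) auto
  then have ax: "a \<le> x" by (simp add: x_def)
  have "- ln (b - x) - (- ln (b - a)) \<le> policy_time M a x"
  proof (rule policy_time_ge_antiderivative[OF int ax, where h = "\<lambda>u. b - u"])
    fix u assume u: "a \<le> u" "u \<le> x"
    have "set_integrable lborel {u..} (\<lambda>u. 1 - cdf M u)"
      by (rule set_integrable_subset[OF int]) (use u in auto)
    then show "excess M u \<le> b - u"
      by (rule excess_le_distance_to_upper_end[OF _ real]) (use u xb in auto)
    show "((\<lambda>u. - ln (b - u)) has_real_derivative 1 / (b - u)) (at u)"
      using u xb by (auto intro!: derivative_eq_intros)
    show "isCont (\<lambda>u. 1 / (b - u)) u"
      using u xb by (auto intro!: continuous_intros)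
  qed (use real xb in auto)
  moreover have "- ln (b - x) - (- ln (b - a)) = s"
    using ab by (simp add: x_def ln_mult)
  ultimately show thesis using that ax xb real by auto
next
  case PInf
  have pos: "0 < excess M a" by (rule excess_pos[OF int a])
  define x where "x = a + s * excess M a"
  have ax: "a \<le> x" using pos s by (simp add: x_def)
  have "x / excess M a - a / excess M a \<le> policy_time M a x"
  proof (rule policy_time_ge_antiderivative[OF int ax, where h = "\<lambda>u. excess M a"])
    fix u assume u: "a \<le> u" "u \<le> x"
    have "0 \<le> (u - a) * (1 - cdf M u)" using u cdf_bounded_prob[of u] by simp
    with excess_decrease_bounds(1)[OF int u(1)] show "excess M u \<le> excess M a" by simp
    show "((\<lambda>u. u / excess M a) has_real_derivative 1 / excess M a) (at u)"
      using pos by (auto intro!: derivative_eq_intros)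
  qed (use PInf in auto)
  moreover have "x / excess M a - a / excess M a = s"
    using pos by (simp add: x_def field_simps)
  ultimately show thesis using that ax PInf by auto
qed (use a in auto)

text \<open>
  The intermediate value theorem for \<open>\<Psi>\<close>. It guarantees that the inverse function in
  \<^const>\<open>optimal_policy\<close> is evaluated at a point where it is an actual inverse.
\<close>

lemma policy_time_surjective:
  assumes int: "set_integrable lborel {a..} (\<lambda>u. 1 - cdf M u)"
    and a: "ereal a < upper_end M" and s: "0 \<le> s"
  shows "s \<in> policy_time M a ` {x. a \<le> x \<and> ereal x < upper_end M}"
proof -
  obtain x where x: "a \<le> x" "ereal x < upper_end M" "s \<le> policy_time M a x"
    using policy_time_unbounded[OF int a s] .
  have "policy_time M a a = 0"
    by (simp add: policy_time_def set_integral_at_point)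
  with IVT'[OF _ x(3,1) policy_time_continuous_on[OF int x(2)]] s
  obtain y where "a \<le> y" "y \<le> x" "policy_time M a y = s" by auto
  moreover from this x have "ereal y < upper_end M"
    by (auto intro: le_less_trans[of _ "ereal x"])
  ultimately show ?thesis by auto
qed

section \<open>Exponential moments\<close>

lemma integrable_exp_excess_over:
  assumes "integrable M (\<lambda>x. exp (\<delta> * max x 0))" "0 < \<delta>"
  shows "integrable M (\<lambda>x. exp (\<delta> * max (x - a) 0))"
proof (rule Bochner_Integration.integrable_bound)
  show "integrable M (\<lambda>x. exp (\<delta> * \<bar>a\<bar>) * exp (\<delta> * max x 0))" using assms by simp
  have "\<delta> * max (x - a) 0 \<le> \<delta> * (\<bar>a\<bar> + max x 0)" for x
    using \<open>0 < \<delta>\<close> by (intro mult_left_mono) auto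
  then show "AE x in M. norm (exp (\<delta> * max (x - a) 0))
      \<le> norm (exp (\<delta> * \<bar>a\<bar>) * exp (\<delta> * max x 0))"
    by (simp add: exp_add[symmetric] distrib_left)
qed simp

lemma exp_moment_ge_1:
  assumes "integrable M (\<lambda>x. exp (\<delta> * max (x - a) 0))" "0 < \<delta>"
  shows "1 \<le> (LINT x|M. exp (\<delta> * max (x - a) 0))"
proof -
  have "(LINT x|M. 1) \<le> (LINT x|M. exp (\<delta> * max (x - a) 0))"
    by (intro integral_mono assms) (use assms in auto)
  then show ?thesis using prob_space by simp
qed

text \<open>
  Markov's inequality, as \<open>X > v\<close> implies \<open>exp (\<delta> (X - a)\<^sub>+) \<ge> exp (\<delta> (v - a))\<close>.
\<close>

lemma tail_le_exponential:
  assumes int: "integrable M (\<lambda>x. exp (\<delta> * max (x - a) 0))" and d: "0 < \<delta>" and v: "a \<le> v"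
  shows "1 - cdf M v \<le> (LINT x|M. exp (\<delta> * max (x - a) 0)) * exp (- \<delta> * (v - a))"
proof -
  have "1 - cdf M v = prob {v<..}"
    using prob_compl[of "{..v}"] by (simp add: cdf_def2 Compl_eq_Diff_UNIV[symmetric])
  also have "\<dots> \<le> prob {x \<in> space M. exp (\<delta> * (v - a)) \<le> exp (\<delta> * max (x - a) 0)}"
    using d by (intro finite_measure_mono) auto
  also have "\<dots> \<le> (LINT x|M. exp (\<delta> * max (x - a) 0)) / exp (\<delta> * (v - a))"
    by (rule integral_Markov_inequality_measure[OF int, of UNIV]) auto
  finally show ?thesis by (simp add: exp_minus divide_inverse)
qed

end

lemma set_integral_exponential_tail:
  fixes C \<delta> a x :: real
  assumes "0 \<le> C" "0 < \<delta>"
  shows "set_integrable lborel {x..} (\<lambda>v. C * exp (- \<delta> * (v - a)))"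
    and "(LINT v:{x..}|lborel. C * exp (- \<delta> * (v - a))) = C / \<delta> * exp (- \<delta> * (x - a))"
proof -
  let ?f = "\<lambda>v. C * exp (- \<delta> * (v - a))" and ?F = "\<lambda>v. - (C / \<delta>) * exp (- \<delta> * (v - a))"
  have "filterlim (\<lambda>v. - a + v) at_top at_top"
    by (rule filterlim_tendsto_add_at_top[OF tendsto_const filterlim_ident])
  then have "filterlim (\<lambda>v. - \<delta> * (- a + v)) at_bot at_top"
    using \<open>0 < \<delta>\<close> by (intro filterlim_tendsto_neg_mult_at_bot[OF tendsto_const]) auto
  from tendsto_mult[OF tendsto_const[of "- (C / \<delta>)"] filterlim_compose[OF exp_at_bot this]]
  have "(?F \<longlongrightarrow> - (C / \<delta>) * 0) at_top" by simp
  then have "(\<integral>\<^sup>+v. ennreal (?f v) * indicator {x..} v \<partial>lborel) = ennreal (- (C / \<delta>) * 0 - ?F x)"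
    using assms by (intro nn_integral_FTC_atLeast) (auto intro!: derivative_eq_intros)
  moreover have "ennreal (?f v) * indicator {x..} v = ennreal (indicator {x..} v *\<^sub>R ?f v)" for v
    by (simp split: split_indicator)
  ultimately have "(\<integral>\<^sup>+v. ennreal (indicator {x..} v *\<^sub>R ?f v) \<partial>lborel)
      = ennreal (C / \<delta> * exp (- \<delta> * (x - a)))"
    by simp
  then have "has_bochner_integral lborel (\<lambda>v. indicator {x..} v *\<^sub>R ?f v)
      (C / \<delta> * exp (- \<delta> * (x - a)))"
    using assms by (intro has_bochner_integral_nn_integral) auto
  then show "set_integrable lborel {x..} ?f"
    "(LINT v:{x..}|lborel. ?f v) = C / \<delta> * exp (- \<delta> * (x - a))"
    unfolding set_integrable_def set_lebesgue_integral_def has_bochner_integral_iff by auto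
qed

context real_distribution
begin

lemma set_integrable_tail:
  assumes int: "integrable M (\<lambda>x. exp (\<delta> * max (x - a) 0))" and d: "0 < \<delta>" and x: "a \<le> x"
  shows "set_integrable lborel {x..} (\<lambda>u. 1 - cdf M u)"
proof (rule set_integrable_bound)
  let ?C = "LINT x|M. exp (\<delta> * max (x - a) 0)"
  have C: "0 \<le> ?C" using exp_moment_ge_1[OF int d] by simp
  show "set_integrable lborel {x..} (\<lambda>v. ?C * exp (- \<delta> * (v - a)))"
    by (rule set_integral_exponential_tail(1)[OF C d])
  show "set_borel_measurable lborel {x..} (\<lambda>u. 1 - cdf M u)"
    by (simp add: set_borel_measurable_def)
  show "AE v in lborel. v \<in> {x..} \<longrightarrow> norm (1 - cdf M v) \<le> norm (?C * exp (- \<delta> * (v - a)))"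
    using tail_le_exponential[OF int d] x C by (auto simp: cdf_bounded_prob)
qed

lemma excess_le_exponential:
  assumes int: "integrable M (\<lambda>x. exp (\<delta> * max (x - a) 0))" and d: "0 < \<delta>" and x: "a \<le> x"
  shows "excess M x \<le> (LINT x|M. exp (\<delta> * max (x - a) 0)) / \<delta> * exp (- \<delta> * (x - a))"
proof -
  let ?C = "LINT x|M. exp (\<delta> * max (x - a) 0)"
  have C: "0 \<le> ?C" using exp_moment_ge_1[OF int d] by simp
  have "excess M x \<le> (LINT v:{x..}|lborel. ?C * exp (- \<delta> * (v - a)))"
    unfolding excess_def
    using set_integrable_tail[OF int d x] set_integral_exponential_tail(1)[OF C d]
    by (rule set_integral_mono) (use tail_le_exponential[OF int d] x in auto)
  then show ?thesis by (simp only: set_integral_exponential_tail(2)[OF C d])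
qed

text \<open>
  The antiderivative bound for \<open>h(u) = (C / \<delta>) exp (-\<delta> (u - a))\<close>, whose reciprocal is the
  derivative of \<open>exp (\<delta> (u - a)) / C\<close>.
\<close>

lemma policy_time_ge_exponential:
  assumes int: "integrable M (\<lambda>x. exp (\<delta> * max (x - a) 0))" and d: "0 < \<delta>"
    and x: "a \<le> x" "ereal x < upper_end M"
  shows "(exp (\<delta> * (x - a)) - 1) / (LINT x|M. exp (\<delta> * max (x - a) 0)) \<le> policy_time M a x"
proof -
  define C where "C = (LINT x|M. exp (\<delta> * max (x - a) 0))"
  have C: "0 < C" using exp_moment_ge_1[OF int d] by (simp add: C_def)
  have "exp (\<delta> * (x - a)) / C - exp (\<delta> * (a - a)) / C \<le> policy_time M a x"
  proof (rule policy_time_ge_antiderivative[OF set_integrable_tail[OF int d order_refl] x,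
        where h = "\<lambda>u. C / \<delta> * exp (- \<delta> * (u - a))"])
    fix u assume u: "a \<le> u" "u \<le> x"
    show "excess M u \<le> C / \<delta> * exp (- \<delta> * (u - a))"
      unfolding C_def by (rule excess_le_exponential[OF int d u(1)])
    show "((\<lambda>u. exp (\<delta> * (u - a)) / C)
        has_real_derivative 1 / (C / \<delta> * exp (- \<delta> * (u - a)))) (at u)"
      using C d by (auto intro!: derivative_eq_intros simp: field_simps simp flip: exp_add)
    show "isCont (\<lambda>u. 1 / (C / \<delta> * exp (- \<delta> * (u - a)))) u"
      using C d by (auto intro!: continuous_intros)
  qed
  then show ?thesis by (simp add: C_def diff_divide_distrib)
qed

end

section \<open>The bound on the optimal policy\<close>

theorem theorem2p4:
  fixes D D\<^sub>0 :: "real measure" and l \<mu>\<^sub>0 \<delta> t :: real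
  assumes "real_distribution D" and "real_distribution D\<^sub>0"
    and "l > 0"
    and "integrable D (\<lambda>x. max x 0)"
    and "integrable D\<^sub>0 (\<lambda>x. \<bar>x\<bar>)"
    and "\<mu>\<^sub>0 = (LINT x|D\<^sub>0. x)"
    and "0 \<le> \<mu>\<^sub>0" and "ereal \<mu>\<^sub>0 < upper_end D"
    and "\<delta> > 0" and "integrable D (\<lambda>x. exp (\<delta> * max x 0))"
    and "t \<ge> 0"
  shows "optimal_policy D l \<mu>\<^sub>0 t
    \<le> \<mu>\<^sub>0 + 1 / \<delta> * ln ((LINT x|D. exp (\<delta> * max (x - \<mu>\<^sub>0) 0)) * (l * t) + 1)"
proof -
  interpret real_distribution D by fact
  define C where "C = (LINT x|D. exp (\<delta> * max (x - \<mu>\<^sub>0) 0))"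
  define x where "x = optimal_policy D l \<mu>\<^sub>0 t"
  have int: "integrable D (\<lambda>x. exp (\<delta> * max (x - \<mu>\<^sub>0) 0))"
    by (rule integrable_exp_excess_over) fact+
  have C: "0 < C" using exp_moment_ge_1[OF int \<open>\<delta> > 0\<close>] by (simp add: C_def)
  have lt: "0 \<le> l * t" using \<open>l > 0\<close> \<open>t \<ge> 0\<close> by simp
  have mem: "l * t \<in> policy_time D \<mu>\<^sub>0 ` {x. \<mu>\<^sub>0 \<le> x \<and> ereal x < upper_end D}"
    by (rule policy_time_surjective[OF set_integrable_tail[OF int \<open>\<delta> > 0\<close> order_refl]]) fact+
  have x: "\<mu>\<^sub>0 \<le> x" "ereal x < upper_end D"
    using inv_into_into[OF mem] by (auto simp: x_def optimal_policy_def)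
  have "policy_time D \<mu>\<^sub>0 x = l * t"
    using f_inv_into_f[OF mem] by (simp add: x_def optimal_policy_def)
  then have "(exp (\<delta> * (x - \<mu>\<^sub>0)) - 1) / C \<le> l * t"
    using policy_time_ge_exponential[OF int \<open>\<delta> > 0\<close> x] by (simp add: C_def)
  then have "exp (\<delta> * (x - \<mu>\<^sub>0)) \<le> C * (l * t) + 1"
    using C by (simp add: field_simps)
  then have "\<delta> * (x - \<mu>\<^sub>0) \<le> ln (C * (l * t) + 1)"
    using C lt by (subst ln_ge_iff) (auto intro: add_nonneg_pos)
  then have "x \<le> \<mu>\<^sub>0 + 1 / \<delta> * ln (C * (l * t) + 1)"
    using \<open>\<delta> > 0\<close> by (simp add: field_simps)
  then show ?thesis by (simp add: x_def C_def)
qed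

end
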